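(* Let $k$ and $r$ be fixed integers with $k>r\ge0$, let $i=\sqrt{-1}$, and let $n\ge0$ be an integer. If $k-r$ is even, then $$\sum_{m=0}^nL_{km+r}L_{k(n-m)+r}=L_{k-r}\left((n+1)L_{k(n+1)+r}-\sum_{j=0}^n(-1)^{(r+1)j}\frac{\sqrt5F_k(L_{k-r}i)^j}{2}\left(\frac{(-1)^j}{(\sqrt5F_k+L_ri)^{j+1}}+\frac{1}{(\sqrt5F_k-L_ri)^{j+1}}\right)(n-j+1)L_{k(n-j+1)+r}\right).$$ If $k-r$ is odd, then $$\sum_{m=0}^nL_{km+r}L_{k(n-m)+r}=L_{k-r}\left(-(n+1)L_{k(n+1)+r}+\sum_{j=0}^n(-1)^{(r+1)j}\frac{\sqrt5F_kL_{k-r}^j}{2}\left(\frac{(-1)^j}{(\sqrt5F_k+L_r)^{j+1}}+\frac{1}{(\sqrt5F_k-L_r)^{j+1}}\right)(n-j+1)L_{k(n-j+1)+r}\right).$$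
   Context: $F_n$ denotes the Fibonacci numbers ($F_0=0$, $F_1=1$, $F_n=F_{n-1}+F_{n-2}$) and $L_n$ the Lucas numbers ($L_0=2$, $L_1=1$, $L_n=L_{n-1}+L_{n-2}$). *)

theory Defs
  imports Complex_Main "HOL-Number_Theory.Fib"
begin

fun lucas :: "nat \<Rightarrow> nat" where
  "lucas 0 = 2"
| "lucas (Suc 0) = 1"
| "lucas (Suc (Suc n)) = lucas (Suc n) + lucas n"

end

theory Submission
  imports Defs "HOL-Computational_Algebra.Formal_Power_Series"
begin

text \<open>
  Put \<open>A = (\<Sum>m. L\<^bsub>km+r\<^esub> X^m) = N / D\<close>, where by the Binet formula \<open>N\<close> is linear and \<open>D\<close> is quadratic.
  The left-hand side is a coefficient of \<open>A\<^sup>2 = N\<^sup>2 / D\<^sup>2\<close>, while the numbers \<open>(m + 1) L\<^bsub>k(m+1)+r\<^esub>\<close> are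
  the coefficients of the derivative \<open>A' = (N' D - N D') / D\<^sup>2\<close>. Writing \<open>e = (-1)^(k-r)\<close>, the numerator
  satisfies \<open>L\<^bsub>k-r\<^esub> (N' D - N D') = 5 F\<^sub>k\<^sup>2 + e N\<^sup>2\<close>, so that
  \<open>A\<^sup>2 = e L\<^bsub>k-r\<^esub> (1 - G) A'\<close> with \<open>G = 5 F\<^sub>k\<^sup>2 / (5 F\<^sub>k\<^sup>2 + e N\<^sup>2)\<close>. Factoring the denominator of \<open>G\<close>
  as \<open>(p + w N) (p - w N)\<close> with \<open>p = \<surd>5 F\<^sub>k\<close> and \<open>w\<^sup>2 = -e\<close>, and expanding the two partial fractions as geometric series gives the
  coefficients on the right-hand side.
\<close>

text \<open>Stated as a product, so that series are compared without dividing. The binomial series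
  of \<open>A\<close> use it with \<open>h = 1\<close>, the two partial fractions of
  \<open>G\<close> with \<open>h = p + L * w\<close> and \<open>h = p - L * w\<close>.\<close>

lemma fps_geometric_mult:
  fixes b h :: "'a :: field"
  assumes "h \<noteq> 0"
  shows "Abs_fps (\<lambda>j. b ^ j / h ^ Suc j) * (fps_const h - fps_const b * fps_X) = 1"
proof (rule fps_ext)
  fix n
  show "fps_nth (Abs_fps (\<lambda>j. b ^ j / h ^ Suc j) * (fps_const h - fps_const b * fps_X)) n = fps_nth 1 n"
    using assms by (cases n) (simp_all add: right_diff_distrib flip: mult.assoc)
qed

text \<open>
  For the application, \<open>u\<close>, \<open>u'\<close> are the \<open>r\<close>-th and \<open>v\<close>, \<open>v'\<close> the \<open>(k-r)\<close>-th powers of the golden ratio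
  and its conjugate.
\<close>

lemma binet_convolution:
  fixes u u' v v' w :: "'a :: field_char_0"
  defines "a \<equiv> \<lambda>m. u * (u * v) ^ m + u' * (u' * v') ^ m"
    and "p \<equiv> u * v - u' * v'" and "L \<equiv> u + u'" and "c \<equiv> v + v'"
    and "t \<equiv> u * u'" and "e \<equiv> v * v'"
  assumes e2: "e ^ 2 = 1" and w2: "w ^ 2 = - e"
    and c0: "c \<noteq> 0" and a1: "a 1 \<noteq> 0"
  shows "(\<Sum>m=0..n. a m * a (n - m)) =
    c * e * (of_nat (n + 1) * a (n + 1) -
      (\<Sum>j=0..n. (- t) ^ j * (p * (c * w) ^ j / 2) *
        ((- 1) ^ j / (p + L * w) ^ (j + 1) + 1 / (p - L * w) ^ (j + 1)) *
        of_nat (n - j + 1) * a (n - j + 1)))"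
proof -
  define h where "h = p + L * w"
  define h' where "h' = p - L * w"
  define z where "z = - t * c * w"
  define A where "A = Abs_fps a"
  define N where "N = fps_const L - fps_const (t * c) * fps_X"
  define D where "D = (1 - fps_const (u * v) * fps_X) * (1 - fps_const (u' * v') * fps_X)"
  define G1 where "G1 = Abs_fps (\<lambda>j. (- z) ^ j / h ^ Suc j)"
  define G2 where "G2 = Abs_fps (\<lambda>j. z ^ j / h' ^ Suc j)"
  define G where "G = fps_const (p / 2) * (G1 + G2)"

  \<comment> \<open>This product is the constant term of the denominator of \<open>G\<close>; the
    assumptions \<open>c0\<close> and \<open>a1\<close> thus make both partial fractions
    expandable.\<close>
  have hh': "h * h' = c * a 1"
  proof -
    have "h * h' = p ^ 2 - L ^ 2 * w ^ 2"
      by (simp add: h_def h'_def power2_eq_square algebra_simps)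
    also have "\<dots> = c * a 1"
      unfolding w2 by (simp add: p_def L_def c_def e_def a_def power2_eq_square algebra_simps)
    finally show ?thesis .
  qed
  with c0 a1 have h0: "h \<noteq> 0" "h' \<noteq> 0"
    by auto

  have AD: "A * D = N"
  proof -
    let ?U = "Abs_fps (\<lambda>m. (u * v) ^ m / 1 ^ Suc m)" and ?V = "Abs_fps (\<lambda>m. (u' * v') ^ m / 1 ^ Suc m)"
    have U: "?U * (1 - fps_const (u * v) * fps_X) = 1"
      using fps_geometric_mult[of 1 "u * v"] by simp
    have V: "?V * (1 - fps_const (u' * v') * fps_X) = 1"
      using fps_geometric_mult[of 1 "u' * v'"] by simp
    have "A = fps_const u * ?U + fps_const u' * ?V"
      by (simp add: A_def a_def fps_eq_iff)
    then have "A * D = fps_const u * (?U * (1 - fps_const (u * v) * fps_X)) * (1 - fps_const (u' * v') * fps_X)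
        + fps_const u' * (?V * (1 - fps_const (u' * v') * fps_X)) * (1 - fps_const (u * v) * fps_X)"
      unfolding D_def by algebra
    also have "\<dots> = N"
      unfolding U V by (simp add: N_def L_def t_def c_def algebra_simps flip: fps_const_add fps_const_mult fps_const_neg)
    finally show ?thesis .
  qed

  have G: "G * (fps_const (p ^ 2) + fps_const e * N ^ 2) = fps_const (p ^ 2)"
  proof -
    let ?P = "fps_const p + fps_const w * N" and ?M = "fps_const p - fps_const w * N"
    have "?P = fps_const h - fps_const (- z) * fps_X"
      by (simp add: h_def z_def N_def algebra_simps flip: fps_const_add fps_const_mult fps_const_neg)
    with fps_geometric_mult[OF h0(1), of "- z"] have P: "G1 * ?P = 1"
      by (simp only: G1_def)
    have "?M = fps_const h' - fps_const z * fps_X"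
      by (simp add: h'_def z_def N_def algebra_simps flip: fps_const_add fps_const_mult fps_const_sub fps_const_neg)
    with fps_geometric_mult[OF h0(2), of z] have M: "G2 * ?M = 1"
      by (simp only: G2_def)
    have we: "fps_const w * fps_const w = - fps_const e"
      using w2 by (simp add: power2_eq_square)
    have "fps_const (p ^ 2) + fps_const e * N ^ 2 = ?P * ?M"
      using we unfolding power2_eq_square fps_const_mult[symmetric] by algebra
    then have "G * (fps_const (p ^ 2) + fps_const e * N ^ 2) =
        fps_const (p / 2) * ((G1 * ?P) * ?M + (G2 * ?M) * ?P)"
      unfolding G_def by algebra
    \<comment> \<open>The multiples of \<open>N\<close> cancel in \<open>?M + ?P\<close>, leaving
      \<open>2 * p\<close>; this explains the factor \<open>p / 2\<close> in
      \<open>G\<close>.\<close>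
    also have "\<dots> = fps_const (p / 2) * (fps_const p + fps_const p)"
      unfolding P M by algebra
    also have "\<dots> = fps_const (p ^ 2)"
      by (simp add: power2_eq_square)
    finally show ?thesis .
  qed

  have N': "fps_deriv N = - fps_const (t * c)"
    by (simp add: N_def)
  \<comment> \<open>The quotient rule for \<open>N / D\<close>, obtained by differentiating
    \<open>A * D = N\<close>.\<close>
  have A'D: "fps_deriv A * D ^ 2 = fps_deriv N * D - N * fps_deriv D"
  proof -
    have "fps_deriv N = A * fps_deriv D + fps_deriv A * D"
      unfolding AD[symmetric] by simp
    then show ?thesis
      unfolding AD[symmetric] by algebra
  qed

  \<comment> \<open>After unfolding, a polynomial identity in \<open>u\<close>, \<open>u'\<close>,
    \<open>v\<close>, \<open>v'\<close> and \<open>fps_X\<close>.\<close>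
  have key: "fps_const c * (fps_deriv N * D - N * fps_deriv D) = fps_const (p ^ 2) + fps_const e * N ^ 2"
  proof -
    have D': "fps_deriv D = - fps_const (u * v) * (1 - fps_const (u' * v') * fps_X)
        - fps_const (u' * v') * (1 - fps_const (u * v) * fps_X)"
      by (simp add: D_def algebra_simps flip: fps_const_mult fps_const_neg)
    show ?thesis
      unfolding N' D' unfolding D_def N_def p_def L_def c_def e_def t_def power2_eq_square
        fps_const_add[symmetric] fps_const_sub[symmetric] fps_const_mult[symmetric]
      by algebra
  qed

  have "A ^ 2 = fps_const (c * e) * (fps_deriv A - G * fps_deriv A)"
  proof -
    let ?Q = "fps_const (p ^ 2) + fps_const e * N ^ 2"
    have ee: "fps_const e * fps_const e = 1"
      using e2 by (simp add: power2_eq_square)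
    \<comment> \<open>Both sides are multiplied by \<open>?Q * D ^ 2\<close>, which can be cancelled
      because \<open>?Q\<close> and \<open>D\<close> have nonzero constant terms.\<close>
    have "fps_const (c * e) * (fps_deriv A - G * fps_deriv A) * (?Q * D ^ 2) =
        fps_const e * (?Q - G * ?Q) * (fps_const c * (fps_deriv A * D ^ 2))"
      unfolding fps_const_mult[symmetric] by algebra
    also have "\<dots> = fps_const e * (fps_const e * N ^ 2) * ?Q"
      unfolding A'D key G by simp
    also have "\<dots> = A ^ 2 * (?Q * D ^ 2)"
      using ee unfolding AD[symmetric] by algebra
    finally have "fps_const (c * e) * (fps_deriv A - G * fps_deriv A) * (?Q * D ^ 2) = A ^ 2 * (?Q * D ^ 2)" .
    moreover have "?Q * D ^ 2 \<noteq> 0"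
    proof -
      have "fps_nth ?Q 0 = h * h'"
        using w2 by (simp add: N_def h_def h'_def power2_eq_square algebra_simps)
      then have "?Q \<noteq> 0"
        using h0 by (metis fps_zero_nth mult_eq_0_iff)
      moreover have "fps_nth D 0 = 1"
        by (simp add: D_def)
      then have "D \<noteq> 0"
        by auto
      ultimately show ?thesis
        by simp
    qed
    ultimately show ?thesis
      by simp
  qed
  then have "fps_nth (A ^ 2) n = c * e * (of_nat (n + 1) * a (n + 1) -
      (\<Sum>j=0..n. fps_nth G j * of_nat (n - j + 1) * a (n - j + 1)))"
    by (simp add: fps_mult_nth[of G] A_def mult.assoc)
  moreover have "fps_nth (A ^ 2) n = (\<Sum>m=0..n. a m * a (n - m))"
    by (simp add: power2_eq_square fps_mult_nth A_def)
  moreover have "fps_nth G j = (- t) ^ j * (p * (c * w) ^ j / 2) *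
        ((- 1) ^ j / (p + L * w) ^ (j + 1) + 1 / (p - L * w) ^ (j + 1))" for j
  proof -
    have "(- z) ^ j = (- 1) ^ j * z ^ j" "z ^ j = (- t) ^ j * (c * w) ^ j"
      by (rule power_minus) (simp only: z_def power_mult_distrib mult.assoc)
    then show ?thesis
      by (simp add: G_def G1_def G2_def flip: h_def h'_def) (simp add: algebra_simps)
  qed
  ultimately show ?thesis
    by simp
qed

lemma lucas_closed_form:
  "real (lucas n) = ((1 + sqrt 5) / 2) ^ n + ((1 - sqrt 5) / 2) ^ n"
proof (induction n rule: lucas.induct)
  case (3 n)
  have rec: "x ^ Suc (Suc n) = x ^ Suc n + x ^ n" if "x ^ 2 = x + 1" for x :: real
  proof -
    have "x ^ Suc (Suc n) = x ^ 2 * x ^ n"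
      by (simp add: power2_eq_square mult.assoc)
    then show ?thesis
      unfolding that by (simp add: algebra_simps)
  qed
  have "((1 + sqrt 5) / 2) ^ 2 = (1 + sqrt 5) / 2 + 1" "((1 - sqrt 5) / 2) ^ 2 = (1 - sqrt 5) / 2 + 1"
    by (simp_all add: power2_eq_square field_simps)
  note this[THEN rec]
  with 3 show ?case
    by (simp del: power_Suc)
qed (simp_all add: field_simps)

lemma lucas_pos: "lucas n > 0"
  by (induction n rule: lucas.induct) auto

theorem theorem3:
  fixes k r n :: nat
  assumes "r < k"
  shows
    "(even (k - r) \<longrightarrow>
      (\<Sum>m=0..n. of_nat (lucas (k * m + r)) * of_nat (lucas (k * (n - m) + r)) :: complex) =
      of_nat (lucas (k - r)) *
        (of_nat (n + 1) * of_nat (lucas (k * (n + 1) + r)) -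
         (\<Sum>j=0..n. (- 1) ^ ((r + 1) * j) *
            (of_real (sqrt 5) * of_nat (fib k) * (of_nat (lucas (k - r)) * \<i>) ^ j / 2) *
            ((- 1) ^ j / (of_real (sqrt 5) * of_nat (fib k) + of_nat (lucas r) * \<i>) ^ (j + 1) +
             1 / (of_real (sqrt 5) * of_nat (fib k) - of_nat (lucas r) * \<i>) ^ (j + 1)) *
            of_nat (n - j + 1) * of_nat (lucas (k * (n - j + 1) + r))))) \<and>
     (odd (k - r) \<longrightarrow>
      (\<Sum>m=0..n. real (lucas (k * m + r)) * real (lucas (k * (n - m) + r))) =
      real (lucas (k - r)) *
        (- (real (n + 1) * real (lucas (k * (n + 1) + r))) +
         (\<Sum>j=0..n. (- 1) ^ ((r + 1) * j) *
            (sqrt 5 * real (fib k) * real (lucas (k - r)) ^ j / 2) *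
            ((- 1) ^ j / (sqrt 5 * real (fib k) + real (lucas r)) ^ (j + 1) +
             1 / (sqrt 5 * real (fib k) - real (lucas r)) ^ (j + 1)) *
            real (n - j + 1) * real (lucas (k * (n - j + 1) + r)))))"
proof -
  define x y where "x = (1 + sqrt 5) / 2" and "y = (1 - sqrt 5) / 2"
  define u u' v v' where "u = x ^ r" and "u' = y ^ r" and "v = x ^ (k - r)" and "v' = y ^ (k - r)"
  have xy: "x * y = - 1"
    by (simp add: x_def y_def field_simps)
  have t: "u * u' = (- 1) ^ r" and e: "v * v' = (- 1) ^ (k - r)"
    by (simp_all add: u_def u'_def v_def v'_def xy flip: power_mult_distrib)
  have uv: "u * v = x ^ k" "u' * v' = y ^ k"
    using assms by (simp_all add: u_def u'_def v_def v'_def flip: power_add)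
  have a: "u * (u * v) ^ m + u' * (u' * v') ^ m = real (lucas (k * m + r))" for m
    unfolding uv lucas_closed_form
    by (simp add: u_def u'_def x_def y_def power_add power_mult mult.commute)
  have L: "u + u' = real (lucas r)" and c: "v + v' = real (lucas (k - r))"
    unfolding lucas_closed_form by (simp_all add: u_def u'_def v_def v'_def x_def y_def)
  have p: "u * v - u' * v' = sqrt 5 * real (fib k)"
    unfolding uv using fib_closed_form[of k] by (simp add: x_def y_def)
  have nz: "lucas m \<noteq> 0" for m
    using lucas_pos[of m] by simp
  \<comment> \<open>The right-hand side is \<open>(- t) ^ j\<close>; the sign is needed over both
    the complex and the real numbers.\<close>
  have sgn: "(- 1 :: 'b :: comm_ring_1) ^ ((r + 1) * j) = (- ((- 1) ^ r)) ^ j" for j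
    by (simp only: power_mult Suc_eq_plus1[symmetric] power_Suc mult_minus1)
  show ?thesis
  proof (intro conjI impI, goal_cases)
    case 1
    then show ?case
      \<comment> \<open>Here \<open>e = 1\<close>, so \<open>w\<close> must be a square root of
        -1.\<close>
      using binet_convolution[where u = "of_real u :: complex" and u' = "of_real u'" and v = "of_real v"
          and v' = "of_real v'" and w = \<i> and n = n]
      unfolding of_real_mult[symmetric] of_real_add[symmetric] of_real_diff[symmetric] of_real_power[symmetric]
        a L c p t e sgn
      by (simp add: nz)
  next
    case 2
    then show ?case
      \<comment> \<open>Here \<open>e = -1\<close>, so \<open>w = 1\<close> works over the reals,
        and the factor \<open>c * e\<close> reverses the signs.\<close>
      using binet_convolution[where u = u and u' = u' and v = v and v' = v' and w = 1 and n = n]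
      unfolding a L c p t e sgn
      by (simp add: nz right_diff_distrib)
  qed
qed

end
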